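(* Let $M=(m_{ij})_{1\leq i,j\leq n}$ be an $n\times n$ totally nonnegative real matrix and let $F_M=\sum_{w\in S_n}\Big(\prod_{i=1}^n m_{i,w(i)}\Big)p_{\lambda(w)}\in\mathsf{Sym}$. Then $F_M$ has saturated Newton polytope.
   Context: A real matrix is totally nonnegative if every minor (determinant of a square submatrix) is nonnegative. $\lambda(w)$ is the cycle type of $w\in S_n$ (a partition of $n$), $p_k=\sum_i x_i^k$ and $p_\lambda=p_{\lambda_1}p_{\lambda_2}\cdots$, in the ring $\mathsf{Sym}$ of symmetric functions in $x_1,x_2,\ldots$. A polynomial $g=\sum c_\alpha x^\alpha$ has saturated Newton polytope (SNP) if every lattice point of $\mathrm{conv}\{\alpha:c_\alpha\neq0\}$ is an exponent vector with nonzero coefficient; $f\in\mathsf{Sym}$ is SNP if $f(x_1,\ldots,x_m)$ (setting $x_i=0$ for $i>m$) is SNP for every $m\geq1$. *)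

theory Defs
  imports
    "HOL-Analysis.Finite_Function_Topology"
    "HOL-Analysis.Convex"
    "HOL-Combinatorics.Orbits"
    "Jordan_Normal_Form.Determinant"
    "Jordan_Normal_Form.DL_Submatrix"
begin

section \<open>Totally nonnegative matrices and cycle types\<close>

definition totally_nonneg :: "real mat \<Rightarrow> bool" where
  "totally_nonneg A \<longleftrightarrow>
     (\<forall>I J. I \<subseteq> {0..<dim_row A} \<longrightarrow> J \<subseteq> {0..<dim_col A} \<longrightarrow> card I = card J \<longrightarrow>
        0 \<le> Determinant.det (submatrix A I J))"

text \<open>A partition is represented by the multiset of its parts. The orbits of \<^term>\<open>w\<close> on
  \<^term>\<open>{0..<n}\<close> are its cycles, fixed points included.\<close>

definition cycle_type :: "nat \<Rightarrow> (nat \<Rightarrow> nat) \<Rightarrow> nat multiset" where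
  "cycle_type n w = image_mset card (mset_set (orbit w ` {0..<n}))"


section \<open>Monomials\<close>

text \<open>A monomial in the variables \<open>x\<^sub>0, x\<^sub>1, \<dots>\<close> is given by its finitely supported exponent
  vector. Indices start at 0, so the first \<open>m\<close> variables are those with index below \<open>m\<close>.\<close>

type_synonym monom = "nat \<Rightarrow>\<^sub>0 nat"

definition tdeg :: "monom \<Rightarrow> nat" where
  "tdeg \<alpha> = (\<Sum>i\<in>Poly_Mapping.keys \<alpha>. Poly_Mapping.lookup \<alpha> i)"

lemma tdeg_superset:
  assumes "finite K" "Poly_Mapping.keys \<alpha> \<subseteq> K"
  shows "tdeg \<alpha> = (\<Sum>i\<in>K. Poly_Mapping.lookup \<alpha> i)"
  unfolding tdeg_def using assms
  by (intro sum.mono_neutral_left) (auto simp: in_keys_iff)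

lemma tdeg_add: "tdeg (\<alpha> + \<beta>) = tdeg \<alpha> + tdeg \<beta>"
proof -
  let ?K = "Poly_Mapping.keys \<alpha> \<union> Poly_Mapping.keys \<beta>"
  have "tdeg (\<alpha> + \<beta>) = (\<Sum>i\<in>?K. Poly_Mapping.lookup (\<alpha> + \<beta>) i)"
    using Poly_Mapping.keys_add[of \<alpha> \<beta>] by (intro tdeg_superset) auto
  also have "\<dots> = (\<Sum>i\<in>?K. Poly_Mapping.lookup \<alpha> i) + (\<Sum>i\<in>?K. Poly_Mapping.lookup \<beta> i)"
    by (simp add: lookup_add sum.distrib)
  also have "\<dots> = tdeg \<alpha> + tdeg \<beta>"
    using tdeg_superset[of ?K \<alpha>] tdeg_superset[of ?K \<beta>] by simp
  finally show ?thesis .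
qed

lemma lookup_le_tdeg: "Poly_Mapping.lookup \<alpha> i \<le> tdeg \<alpha>"
  unfolding tdeg_def
  by (cases "i \<in> Poly_Mapping.keys \<alpha>") (auto intro: member_le_sum simp: in_keys_iff)

lemma finite_bounded_monoms:
  assumes "finite K"
  shows "finite {\<alpha>::monom. Poly_Mapping.keys \<alpha> \<subseteq> K \<and> (\<forall>i. Poly_Mapping.lookup \<alpha> i \<le> N)}"
    (is "finite ?S")
proof -
  have "finite {f. \<forall>x. (x \<in> K \<longrightarrow> f x \<in> {..N}) \<and> (x \<notin> K \<longrightarrow> f x = (0::nat))}"
    using assms by (intro finite_set_of_finite_funs) auto
  moreover have "Poly_Mapping.lookup ` ?S \<subseteq>
      {f. \<forall>x. (x \<in> K \<longrightarrow> f x \<in> {..N}) \<and> (x \<notin> K \<longrightarrow> f x = 0)}"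
    by (auto simp: in_keys_iff subset_iff)
  ultimately have "finite (Poly_Mapping.lookup ` ?S)"
    by (rule finite_subset[rotated])
  thus ?thesis
    by (rule finite_imageD) (auto simp: inj_on_def intro: poly_mapping_eqI)
qed

definition splits :: "monom \<Rightarrow> (monom \<times> monom) set" where
  "splits \<gamma> = {(\<alpha>, \<beta>). \<alpha> + \<beta> = \<gamma>}"

lemma finite_splits: "finite (splits \<gamma>)"
proof -
  let ?S = "{\<alpha>::monom. Poly_Mapping.keys \<alpha> \<subseteq> Poly_Mapping.keys \<gamma> \<and>
    (\<forall>i. Poly_Mapping.lookup \<alpha> i \<le> tdeg \<gamma>)}"
  have *: "\<alpha> \<in> ?S \<and> \<beta> \<in> ?S" if "\<alpha> + \<beta> = \<gamma>" for \<alpha> \<beta>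
    using that lookup_le_tdeg[of \<alpha>] lookup_le_tdeg[of \<beta>]
    by (force simp: in_keys_iff lookup_add tdeg_add intro: order_trans trans_le_add1 trans_le_add2)
  have "splits \<gamma> \<subseteq> ?S \<times> ?S"
    unfolding splits_def using * by blast
  moreover have "finite ?S"
    using finite_bounded_monoms[of "Poly_Mapping.keys \<gamma>" "tdeg \<gamma>"] by simp
  ultimately show ?thesis
    by (blast intro: finite_subset[OF _ finite_cartesian_product])
qed

lemma bij_betw_map_key_splits:
  assumes "bij \<sigma>"
  shows "bij_betw (map_prod (Poly_Mapping.map_key \<sigma>) (Poly_Mapping.map_key \<sigma>))
           (splits \<gamma>) (splits (Poly_Mapping.map_key \<sigma> \<gamma>))"
proof -
  have inj: "inj \<sigma>" "inj (inv_into UNIV \<sigma>)"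
    using assms by (auto simp: bij_is_inj bij_imp_bij_inv)
  have 1: "Poly_Mapping.map_key (inv_into UNIV \<sigma>) (Poly_Mapping.map_key \<sigma> \<alpha>) = \<alpha>" for \<alpha> :: monom
    using assms inj by (intro poly_mapping_eqI) (simp add: map_key.rep_eq bij_is_surj surj_f_inv_f)
  have 2: "Poly_Mapping.map_key \<sigma> (Poly_Mapping.map_key (inv_into UNIV \<sigma>) \<alpha>) = \<alpha>" for \<alpha> :: monom
    using assms inj by (intro poly_mapping_eqI) (simp add: map_key.rep_eq)
  have mk_plus: "Poly_Mapping.map_key \<tau> (\<alpha> + \<beta>) =
      Poly_Mapping.map_key \<tau> \<alpha> + Poly_Mapping.map_key \<tau> \<beta>" if "inj \<tau>" for \<tau> and \<alpha> \<beta> :: monom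
    using that by (intro poly_mapping_eqI) (simp add: map_key.rep_eq lookup_add)
  show ?thesis
    by (rule bij_betwI[where g = "map_prod (Poly_Mapping.map_key (inv_into UNIV \<sigma>)) (Poly_Mapping.map_key (inv_into UNIV \<sigma>))"])
       (auto simp: splits_def 1 2 mk_plus[OF inj(1), symmetric]
             mk_plus[OF inj(2), symmetric])
qed


section \<open>The ring of symmetric functions\<close>

text \<open>A symmetric function is a formal power series in infinitely many variables, given by its
  coefficients, that has bounded degree and is invariant under permutations of the variables.\<close>

definition is_symfun :: "(monom \<Rightarrow> real) \<Rightarrow> bool" where
  "is_symfun c \<longleftrightarrow>
     (\<exists>d. \<forall>\<alpha>. c \<alpha> \<noteq> 0 \<longrightarrow> tdeg \<alpha> \<le> d) \<and>
     (\<forall>\<sigma> \<alpha>. bij \<sigma> \<longrightarrow> c (Poly_Mapping.map_key \<sigma> \<alpha>) = c \<alpha>)"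

lemma is_symfunI:
  assumes "\<And>\<alpha>. c \<alpha> \<noteq> 0 \<Longrightarrow> tdeg \<alpha> \<le> d"
    and "\<And>\<sigma> \<alpha>. bij \<sigma> \<Longrightarrow> c (Poly_Mapping.map_key \<sigma> \<alpha>) = c \<alpha>"
  shows "is_symfun c"
  using assms unfolding is_symfun_def by blast

lemma is_symfun_permute:
  "is_symfun c \<Longrightarrow> bij \<sigma> \<Longrightarrow> c (Poly_Mapping.map_key \<sigma> \<alpha>) = c \<alpha>"
  unfolding is_symfun_def by blast

typedef symfun = "{c :: monom \<Rightarrow> real. is_symfun c}"
  morphisms scoeff Abs_symfun
  by (rule exI[of _ "\<lambda>_. 0"]) (simp add: is_symfun_def)

setup_lifting type_definition_symfun

lemma map_key_eq_0_iff:
  assumes "bij \<sigma>"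
  shows "Poly_Mapping.map_key \<sigma> \<alpha> = 0 \<longleftrightarrow> \<alpha> = (0::monom)"
proof
  assume *: "Poly_Mapping.map_key \<sigma> \<alpha> = 0"
  show "\<alpha> = 0"
  proof (rule poly_mapping_eqI)
    fix i
    obtain j where "i = \<sigma> j" using assms by (meson bij_pointE)
    thus "Poly_Mapping.lookup \<alpha> i = Poly_Mapping.lookup 0 i"
      using arg_cong[OF *, of "\<lambda>p. Poly_Mapping.lookup p j"] assms
      by (simp add: map_key.rep_eq bij_is_inj)
  qed
qed (use assms in \<open>simp add: map_key_zero bij_is_inj\<close>)

definition conv :: "(monom \<Rightarrow> real) \<Rightarrow> (monom \<Rightarrow> real) \<Rightarrow> monom \<Rightarrow> real" where
  "conv f g \<gamma> = (\<Sum>(\<alpha>, \<beta>)\<in>splits \<gamma>. f \<alpha> * g \<beta>)"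

lemma conv_commute: "conv f g \<gamma> = conv g f \<gamma>"
  unfolding conv_def
  by (rule sum.reindex_bij_witness[of _ prod.swap prod.swap])
     (auto simp: splits_def add.commute mult.commute)

lemma conv_assoc: "conv (conv f g) h \<gamma> = conv f (conv g h) \<gamma>"
proof -
  have "conv (conv f g) h \<gamma> =
      (\<Sum>((\<delta>, \<epsilon>), (\<alpha>, \<beta>))\<in>(SIGMA p:splits \<gamma>. splits (fst p)). f \<alpha> * g \<beta> * h \<epsilon>)"
    unfolding conv_def
    by (simp add: case_prod_unfold sum_distrib_right sum.Sigma finite_splits)
  also have "\<dots> =
      (\<Sum>((\<alpha>, \<delta>), (\<beta>, \<epsilon>))\<in>(SIGMA p:splits \<gamma>. splits (snd p)). f \<alpha> * (g \<beta> * h \<epsilon>))"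
    by (rule sum.reindex_bij_witness[of _
          "\<lambda>((\<alpha>, \<delta>), (\<beta>, \<epsilon>)). ((\<alpha> + \<beta>, \<epsilon>), (\<alpha>, \<beta>))"
          "\<lambda>((\<delta>, \<epsilon>), (\<alpha>, \<beta>)). ((\<alpha>, \<beta> + \<epsilon>), (\<beta>, \<epsilon>))"])
       (auto simp: splits_def add.assoc mult.assoc)
  also have "\<dots> = conv f (conv g h) \<gamma>"
    unfolding conv_def
    by (simp add: case_prod_unfold sum_distrib_left sum.Sigma finite_splits)
  finally show ?thesis .
qed

lemma conv_1_left: "conv (\<lambda>\<alpha>. if \<alpha> = 0 then 1 else 0) f \<gamma> = f \<gamma>"
proof -
  have "conv (\<lambda>\<alpha>. if \<alpha> = 0 then 1 else 0) f \<gamma> =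
      (\<Sum>p\<in>splits \<gamma>. if p = (0, \<gamma>) then f \<gamma> else 0)"
    unfolding conv_def by (intro sum.cong) (auto simp: splits_def split: if_splits)
  also have "\<dots> = f \<gamma>"
    using finite_splits[of \<gamma>] by (simp add: splits_def)
  finally show ?thesis .
qed

lemma conv_distrib_right: "conv (\<lambda>\<alpha>. f \<alpha> + g \<alpha>) h \<gamma> = conv f h \<gamma> + conv g h \<gamma>"
  unfolding conv_def by (simp add: case_prod_unfold distrib_right sum.distrib)

lemma conv_1_right: "conv f (\<lambda>\<alpha>. if \<alpha> = 0 then 1 else 0) \<gamma> = f \<gamma>"
  using conv_1_left[of f \<gamma>] by (simp only: conv_commute[of f])

lemma conv_distrib_left: "conv f (\<lambda>\<alpha>. g \<alpha> + h \<alpha>) \<gamma> = conv f g \<gamma> + conv f h \<gamma>"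
  unfolding conv_def by (simp add: case_prod_unfold distrib_left sum.distrib)

lemma conv_scale_left: "conv (\<lambda>\<alpha>. r * f \<alpha>) h \<gamma> = r * conv f h \<gamma>"
  unfolding conv_def by (simp add: case_prod_unfold sum_distrib_left mult.assoc)

lemma conv_scale_right: "conv f (\<lambda>\<alpha>. r * h \<alpha>) \<gamma> = r * conv f h \<gamma>"
  unfolding conv_def by (simp add: case_prod_unfold sum_distrib_left mult.left_commute)

instantiation symfun :: "{comm_ring_1, real_algebra_1}"
begin

lift_definition zero_symfun :: symfun is "\<lambda>_. 0"
  by (simp add: is_symfun_def)

lift_definition one_symfun :: symfun is "\<lambda>\<alpha>. if \<alpha> = 0 then 1 else 0"
  by (rule is_symfunI[of _ 0]) (auto simp: map_key_eq_0_iff tdeg_def split: if_splits)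

lift_definition plus_symfun :: "symfun \<Rightarrow> symfun \<Rightarrow> symfun" is "\<lambda>f g \<alpha>. f \<alpha> + g \<alpha>"
proof -
  fix f g :: "monom \<Rightarrow> real"
  assume f: "is_symfun f" and g: "is_symfun g"
  obtain d where d: "\<And>\<alpha>. f \<alpha> \<noteq> 0 \<Longrightarrow> tdeg \<alpha> \<le> d" using f unfolding is_symfun_def by blast
  obtain e where e: "\<And>\<alpha>. g \<alpha> \<noteq> 0 \<Longrightarrow> tdeg \<alpha> \<le> e" using g unfolding is_symfun_def by blast
  have "tdeg \<alpha> \<le> max d e" if "f \<alpha> + g \<alpha> \<noteq> 0" for \<alpha>
    using d[of \<alpha>] e[of \<alpha>] that by fastforce
  moreover have "f (Poly_Mapping.map_key \<sigma> \<alpha>) + g (Poly_Mapping.map_key \<sigma> \<alpha>) = f \<alpha> + g \<alpha>"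
    if "bij \<sigma>" for \<sigma> \<alpha>
    by (simp only: is_symfun_permute[OF f that] is_symfun_permute[OF g that])
  ultimately show "is_symfun (\<lambda>\<alpha>. f \<alpha> + g \<alpha>)"
    by (rule is_symfunI)
qed

lift_definition scaleR_symfun :: "real \<Rightarrow> symfun \<Rightarrow> symfun" is "\<lambda>r f \<alpha>. r * f \<alpha>"
  unfolding is_symfun_def by auto

lift_definition uminus_symfun :: "symfun \<Rightarrow> symfun" is "\<lambda>f \<alpha>. - f \<alpha>"
  unfolding is_symfun_def by auto

definition minus_symfun :: "symfun \<Rightarrow> symfun \<Rightarrow> symfun" where
  "f - g = f + (- g)" for f g :: symfun

lift_definition times_symfun :: "symfun \<Rightarrow> symfun \<Rightarrow> symfun" is conv
proof -
  fix f g :: "monom \<Rightarrow> real"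
  assume f: "is_symfun f" and g: "is_symfun g"
  obtain d where d: "\<And>\<alpha>. f \<alpha> \<noteq> 0 \<Longrightarrow> tdeg \<alpha> \<le> d" using f unfolding is_symfun_def by blast
  obtain e where e: "\<And>\<alpha>. g \<alpha> \<noteq> 0 \<Longrightarrow> tdeg \<alpha> \<le> e" using g unfolding is_symfun_def by blast
  have "tdeg \<gamma> \<le> d + e" if nz: "conv f g \<gamma> \<noteq> 0" for \<gamma>
  proof -
    obtain p where "p \<in> splits \<gamma>" "(case p of (\<alpha>, \<beta>) \<Rightarrow> f \<alpha> * g \<beta>) \<noteq> 0"
      using sum.not_neutral_contains_not_neutral[OF nz[unfolded conv_def]] by blast
    then obtain \<alpha> \<beta> where "\<alpha> + \<beta> = \<gamma>" "f \<alpha> * g \<beta> \<noteq> 0"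
      by (cases p) (simp add: splits_def)
    thus ?thesis using d[of \<alpha>] e[of \<beta>] by (auto simp: tdeg_add)
  qed
  moreover have "conv f g (Poly_Mapping.map_key \<sigma> \<gamma>) = conv f g \<gamma>" if "bij \<sigma>" for \<sigma> \<gamma>
    unfolding conv_def
    by (subst sum.reindex_bij_betw[OF bij_betw_map_key_splits[OF that], symmetric])
       (simp add: case_prod_unfold is_symfun_permute[OF f that] is_symfun_permute[OF g that])
  ultimately show "is_symfun (conv f g)"
    by (rule is_symfunI)
qed

instance
proof
  fix a b c :: symfun and r s :: real
  show "a + b + c = a + (b + c)" by transfer (simp add: add.assoc)
  show "a + b = b + a" by transfer (simp add: add.commute)
  show "0 + a = a" by transfer simp
  show "- a + a = 0" by transfer simp
  show "a - b = a + - b" by (rule minus_symfun_def)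
  show "a * b * c = a * (b * c)" by transfer (rule ext, rule conv_assoc)
  show "a * b = b * a" by transfer (rule ext, rule conv_commute)
  show "1 * a = a" by transfer (rule ext, rule conv_1_left)
  show "a * (b + c) = a * b + a * c"
    by transfer (rule ext, rule conv_distrib_left)
  show "a * 1 = a" by transfer (rule ext, rule conv_1_right)
  show "(a + b) * c = a * c + b * c" by transfer (rule ext, rule conv_distrib_right)
  show "(0::symfun) \<noteq> 1" by transfer (auto simp: fun_eq_iff)
  show "r *\<^sub>R (a + b) = r *\<^sub>R a + r *\<^sub>R b" by transfer (simp add: distrib_left)
  show "(r + s) *\<^sub>R a = r *\<^sub>R a + s *\<^sub>R a" by transfer (simp add: distrib_right)
  show "r *\<^sub>R s *\<^sub>R a = (r * s) *\<^sub>R a" by transfer (simp add: mult.assoc)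
  show "1 *\<^sub>R a = a" by transfer simp
  show "r *\<^sub>R a * b = r *\<^sub>R (a * b)" by transfer (rule ext, rule conv_scale_left)
  show "a * r *\<^sub>R b = r *\<^sub>R (a * b)" by transfer (rule ext, rule conv_scale_right)
qed

end

text \<open>The power sum \<open>p\<^sub>k\<close> for \<open>k \<ge> 1\<close>. The value 0 at \<open>k = 0\<close> is a dummy: a partition has no part 0.\<close>

lift_definition power_sum :: "nat \<Rightarrow> symfun" is
  "\<lambda>k \<alpha>. if k > 0 \<and> (\<exists>i. \<alpha> = Poly_Mapping.single i k) then 1 else 0"
proof (rule is_symfunI)
  fix k :: nat and \<alpha> :: monom
  assume "(if 0 < k \<and> (\<exists>i. \<alpha> = Poly_Mapping.single i k) then 1 else (0::real)) \<noteq> 0"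
  thus "tdeg \<alpha> \<le> k"
    by (auto simp: tdeg_def split: if_splits)
next
  fix k :: nat and \<sigma> :: "nat \<Rightarrow> nat" and \<alpha> :: monom
  assume \<sigma>: "bij \<sigma>"
  have "(\<exists>i. Poly_Mapping.map_key \<sigma> \<alpha> = Poly_Mapping.single i k) \<longleftrightarrow>
      (\<exists>i. \<alpha> = Poly_Mapping.single i k)"
  proof
    assume "\<exists>i. Poly_Mapping.map_key \<sigma> \<alpha> = Poly_Mapping.single i k"
    then obtain i where i: "Poly_Mapping.map_key \<sigma> \<alpha> = Poly_Mapping.single i k" by blast
    have "\<alpha> = Poly_Mapping.single (\<sigma> i) k"
    proof (rule poly_mapping_eqI)
      fix l
      obtain j where j: "l = \<sigma> j" using \<sigma> by (meson bij_pointE)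
      show "Poly_Mapping.lookup \<alpha> l = Poly_Mapping.lookup (Poly_Mapping.single (\<sigma> i) k) l"
        using arg_cong[OF i, of "\<lambda>p. Poly_Mapping.lookup p j"] \<sigma> j
        by (simp add: map_key.rep_eq bij_is_inj lookup_single inj_eq)
    qed
    thus "\<exists>i. \<alpha> = Poly_Mapping.single i k" by blast
  next
    assume "\<exists>i. \<alpha> = Poly_Mapping.single i k"
    then obtain i where i: "\<alpha> = Poly_Mapping.single i k" by blast
    obtain j where "i = \<sigma> j" using \<sigma> by (meson bij_pointE)
    thus "\<exists>i. Poly_Mapping.map_key \<sigma> \<alpha> = Poly_Mapping.single i k"
      using i \<sigma> by (metis map_key_single bij_is_inj)
  qed
  thus "(if 0 < k \<and> (\<exists>i. Poly_Mapping.map_key \<sigma> \<alpha> = Poly_Mapping.single i k) then 1 else (0::real)) =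
      (if 0 < k \<and> (\<exists>i. \<alpha> = Poly_Mapping.single i k) then 1 else 0)"
    by simp
qed

definition power_sum_partition :: "nat multiset \<Rightarrow> symfun" where
  "power_sum_partition ks = (\<Prod>k\<in>#ks. power_sum k)"


section \<open>Saturated Newton polytopes\<close>

type_synonym mpoly = "monom \<Rightarrow>\<^sub>0 real"

text \<open>The polynomial in the variables with index below \<open>m\<close> obtained by setting all others to 0.\<close>

lift_definition restrict_vars :: "nat \<Rightarrow> symfun \<Rightarrow> mpoly" is
  "\<lambda>m c \<alpha>. if Poly_Mapping.keys \<alpha> \<subseteq> {..<m} then c \<alpha> else 0"
proof -
  fix m :: nat and c :: "monom \<Rightarrow> real"
  assume "is_symfun c"
  then obtain d where d: "\<And>\<alpha>. c \<alpha> \<noteq> 0 \<Longrightarrow> tdeg \<alpha> \<le> d"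
    unfolding is_symfun_def by blast
  have "{\<alpha>. (if Poly_Mapping.keys \<alpha> \<subseteq> {..<m} then c \<alpha> else 0) \<noteq> 0} \<subseteq>
      {\<alpha>. Poly_Mapping.keys \<alpha> \<subseteq> {..<m} \<and> (\<forall>i. Poly_Mapping.lookup \<alpha> i \<le> d)}"
    using d lookup_le_tdeg by (auto intro: order_trans split: if_splits)
  thus "finite {\<alpha>. (if Poly_Mapping.keys \<alpha> \<subseteq> {..<m} then c \<alpha> else 0) \<noteq> 0}"
    using finite_bounded_monoms[of "{..<m}" d] by (simp add: finite_subset)
qed

definition exponent_vector :: "monom \<Rightarrow> (nat \<Rightarrow>\<^sub>0 real)" where
  "exponent_vector \<alpha> = Poly_Mapping.map real \<alpha>"

text \<open>Exponent vectors live in the space of finitely supported real sequences, which contains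
  \<open>\<real>\<^sup>m\<close> for every \<open>m\<close>. The Newton polytope of a polynomial in the first \<open>m\<close> variables lies in
  this \<open>\<real>\<^sup>m\<close>, so its lattice points are the points with integer coordinates.\<close>

definition newton_polytope :: "mpoly \<Rightarrow> (nat \<Rightarrow>\<^sub>0 real) set" where
  "newton_polytope g = convex hull (exponent_vector ` Poly_Mapping.keys g)"

definition SNP_poly :: "mpoly \<Rightarrow> bool" where
  "SNP_poly g \<longleftrightarrow>
     (\<forall>v \<in> newton_polytope g. (\<forall>i. Poly_Mapping.lookup v i \<in> \<int>) \<longrightarrow>
        v \<in> exponent_vector ` Poly_Mapping.keys g)"

definition SNP :: "symfun \<Rightarrow> bool" where
  "SNP f \<longleftrightarrow> (\<forall>m\<ge>1. SNP_poly (restrict_vars m f))"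


section \<open>The symmetric function of a matrix\<close>

definition F_mat :: "real mat \<Rightarrow> symfun" where
  "F_mat M = (\<Sum>w | w permutes {0..<dim_row M}.
     (\<Prod>i = 0..<dim_row M. M $$ (i, w i)) *\<^sub>R power_sum_partition (cycle_type (dim_row M) w))"

end

theory Submission
  imports Defs
begin

text \<open>Power sums have nonnegative coefficients, and so has \<open>F\<^sub>M\<close>, which is homogeneous of degree
  \<open>n\<close>. If \<open>M\<close> has a nonzero generalized diagonal \<open>\<Prod>\<^sub>i m\<^bsub>i,w(i)\<^esub>\<close>, then the nonnegativity of the
  \<open>2 \<times> 2\<close> minors lets us uncross \<open>w\<close> and makes all \<open>m\<^bsub>i,i\<^esub>\<close> positive. The identity permutation then
  contributes a positive multiple of \<open>p\<^sub>1\<^sup>n\<close>, in which every monomial of degree \<open>n\<close> occurs, so the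
  Newton polytope is the full dilated simplex. Otherwise \<open>F\<^sub>M = 0\<close>.\<close>

section \<open>Minors of order at most two\<close>

lemma det_mat_2:
  assumes "A \<in> carrier_mat 2 2"
  shows "Determinant.det A = A $$ (0, 0) * A $$ (1, 1) - A $$ (0, 1) * A $$ (1, 0)"
proof -
  have "mat_delete A 0 j \<in> carrier_mat 1 1" for j
    using assms by (auto simp: mat_delete_def)
  moreover have "{..<2::nat} = {0, 1}"
    by auto
  ultimately show ?thesis
    using laplace_expansion_row[OF assms, of 0] assms
    by (simp add: cofactor_def det_single mat_delete_def)
qed

lemma totally_nonneg_entry:
  assumes "totally_nonneg M" "i < dim_row M" "j < dim_col M"
  shows "0 \<le> M $$ (i, j)"
proof -
  let ?N = "submatrix M {i} {j}"
  have "{k. k < dim_row M \<and> k \<in> {i}} = {i}" "{k. k < dim_col M \<and> k \<in> {j}} = {j}"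
    using assms by auto
  hence N: "?N \<in> carrier_mat 1 1"
    by (intro carrier_matI) (simp_all only: dim_submatrix, simp_all)
  have "Determinant.det ?N = M $$ (i, j)"
    using submatrix_index_card[of i M j "{i}" "{j}"] assms det_single[OF N] by (simp cong: conj_cong)
  moreover have "0 \<le> Determinant.det ?N"
    using assms unfolding totally_nonneg_def by simp
  ultimately show ?thesis
    by simp
qed

lemma totally_nonneg_minor_2:
  assumes "totally_nonneg M" "i < k" "k < dim_row M" "j < l" "l < dim_col M"
  shows "M $$ (i, l) * M $$ (k, j) \<le> M $$ (i, j) * M $$ (k, l)"
proof -
  let ?N = "submatrix M {i, k} {j, l}"
  have "{a. a < dim_row M \<and> a \<in> {i, k}} = {i, k}" "{a. a < dim_col M \<and> a \<in> {j, l}} = {j, l}"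
    using assms by auto
  hence N: "?N \<in> carrier_mat 2 2"
    using assms(2,4) by (intro carrier_matI) (simp_all only: dim_submatrix, simp_all)
  \<comment> \<open>\<open>submatrix_index_card\<close> locates an entry of the submatrix by how
    many selected indices lie below its own. These counts are 0 for \<open>i\<close> and
    \<open>j\<close>, and 1 for \<open>k\<close> and \<open>l\<close>.\<close>
  have "{a \<in> {i, k}. a < i} = {}" "{a \<in> {i, k}. a < k} = {i}"
    "{a \<in> {j, l}. a < j} = {}" "{a \<in> {j, l}. a < l} = {j}"
    using assms by auto
  note * = this[THEN arg_cong[of _ _ card]]
  have "?N $$ (0, 0) = M $$ (i, j)" "?N $$ (1, 1) = M $$ (k, l)"
    "?N $$ (0, 1) = M $$ (i, l)" "?N $$ (1, 0) = M $$ (k, j)"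
    using submatrix_index_card[of i M j "{i, k}" "{j, l}"]
      submatrix_index_card[of k M l "{i, k}" "{j, l}"]
      submatrix_index_card[of i M l "{i, k}" "{j, l}"]
      submatrix_index_card[of k M j "{i, k}" "{j, l}"] assms
    by (simp_all only: *) simp_all
  moreover have "0 \<le> Determinant.det ?N"
    using assms unfolding totally_nonneg_def by simp
  ultimately show ?thesis
    by (simp add: det_mat_2[OF N])
qed

section \<open>Uncrossing a positive generalized diagonal to the main diagonal\<close>

text \<open>Pigeonhole: otherwise \<open>w\<close> would map \<open>{i..<n}\<close> injectively into
  the smaller set \<open>{i<..<n}\<close>.\<close>

lemma permutes_crossing:
  fixes w :: "nat \<Rightarrow> nat"
  assumes w: "w permutes {0..<n}" and i: "i < n" "i < w i"
  obtains k where "i < k" "k < n" "w k \<le> i"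
proof -
  have "\<exists>k\<in>{i<..<n}. w k \<le> i"
  proof (rule ccontr)
    assume contra: "\<not> ?thesis"
    have "i < w a" if "i < a" "a < n" for a
      using contra that by (meson greaterThanLessThan_iff not_le)
    hence "w a \<in> {i<..<n}" if "a \<in> {i..<n}" for a
      using that i permutes_in_image[OF w, of a] by (cases "a = i") auto
    hence "card (w ` {i..<n}) \<le> card {i<..<n}"
      by (intro card_mono image_subsetI) auto
    moreover have "card (w ` {i..<n}) = card {i..<n}"
      using w by (intro card_image) (meson permutes_inj_on)
    ultimately show False
      using i by simp
  qed
  thus thesis
    using that by auto
qed

text \<open>The mirror image: otherwise \<open>w\<close> would map \<open>{..i}\<close> injectively
  into \<open>{..<i}\<close>.\<close>

lemma permutes_crossing':
  fixes w :: "nat \<Rightarrow> nat"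
  assumes w: "w permutes {0..<n}" and i: "i < n" "w i < i"
  obtains k where "k < i" "i \<le> w k"
proof -
  have "\<exists>k<i. i \<le> w k"
  proof (rule ccontr)
    assume "\<not> ?thesis"
    hence "w ` {..i} \<subseteq> {..<i}"
      using i by (force simp: le_eq_less_or_eq not_le)
    hence "card (w ` {..i}) \<le> card {..<i}"
      by (intro card_mono) auto
    moreover have "card (w ` {..i}) = card {..i}"
      using w by (intro card_image) (meson permutes_inj_on)
    ultimately show False
      by simp
  qed
  thus thesis
    using that by auto
qed

text \<open>Row \<open>i\<close> has a positive entry in column \<open>w i\<close>, and column
  \<open>i\<close> has one in row \<open>j\<close>, where \<open>w j = i\<close>. If
  \<open>w i\<close> and \<open>j\<close> lie on the same side of \<open>i\<close>, a single
  uncrossing yields the entry \<open>(i, i)\<close>. If they lie on opposite sides, a first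
  uncrossing with a suitable row \<open>k\<close> moves the positive entry of row \<open>i\<close>
  to the side of \<open>j\<close>.\<close>

lemma totally_nonneg_diagonal_pos:
  assumes M: "M \<in> carrier_mat n n" "totally_nonneg M"
    and w: "w permutes {0..<n}"
    and pos: "\<And>i. i < n \<Longrightarrow> 0 < M $$ (i, w i)"
    and i: "i < n"
  shows "0 < M $$ (i, i)"
proof -
  \<comment> \<open>A positive antidiagonal of a 2 by 2 submatrix makes the product of its diagonal
    positive; as entries are nonnegative, both diagonal factors are positive.\<close>
  have uncross: "0 < M $$ (a, c)" "0 < M $$ (b, d)"
    if "a < b" "b < n" "c < d" "d < n" "0 < M $$ (a, d)" "0 < M $$ (b, c)" for a b c d
  proof -
    have "0 < M $$ (a, d) * M $$ (b, c)"
      using that by simp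
    also have "\<dots> \<le> M $$ (a, c) * M $$ (b, d)"
      using totally_nonneg_minor_2[OF M(2), of a b c d] M(1) that by auto
    finally show "0 < M $$ (a, c)" "0 < M $$ (b, d)"
      using totally_nonneg_entry[OF M(2), of a c] totally_nonneg_entry[OF M(2), of b d] M(1) that
      by (auto simp: zero_less_mult_iff)
  qed
  have lt: "w a < n" if "a < n" for a
    using permutes_in_image[OF w, of a] that by simp
  obtain j where j: "w j = i" "j < n"
    using i permutes_image[OF w] by (metis atLeastLessThan_iff imageE le0)
  have above: "0 < M $$ (i, i)" if "0 < M $$ (i, c)" "i < c" "c < n" "i < j" for c
    using uncross(1)[of i j i c] that pos[of j] i j by simp
  have below: "0 < M $$ (i, i)" if "0 < M $$ (i, c)" "c < i" "j < i" for c
    using uncross(2)[of j i c i] that pos[of j] i j by simp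
  consider "w i = i" | "i < w i" "i < j" | "w i < i" "j < i" | "i < w i" "j < i" | "w i < i" "i < j"
    using j by (metis linorder_neqE_nat)
  thus ?thesis
  proof cases
    case 4
    then obtain k where k: "i < k" "k < n" "w k \<le> i"
      using permutes_crossing[OF w i] by blast
    \<comment> \<open>Equality would give \<open>k = j\<close> by injectivity, but
      \<open>j < i < k\<close>.\<close>
    with 4 j have "w k < i"
      by (metis le_neq_implies_less less_asym permutes_inj[OF w] inj_eq)
    moreover have "0 < M $$ (i, w k)"
      using uncross(1)[of i k "w k" "w i"] k 4 i lt pos by simp
    ultimately show ?thesis
      using below 4 by blast
  next
    case 5
    then obtain k where k: "k < i" "i \<le> w k"
      using permutes_crossing'[OF w i] by blast
    with 5 j have "i < w k"
      by (metis le_neq_implies_less less_asym permutes_inj[OF w] inj_eq)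
    moreover have "0 < M $$ (i, w k)"
      using uncross(2)[of k i "w i" "w k"] k 5 i lt pos by simp
    ultimately show ?thesis
      using above 5 k i lt by simp
  qed (use pos[OF i] above below i lt in auto)
qed

section \<open>Coefficients of products of power sums\<close>

lemma scoeff_sum: "scoeff (sum f A) \<alpha> = (\<Sum>a\<in>A. scoeff (f a) \<alpha>)"
  by (induction A rule: infinite_finite_induct) (simp_all add: zero_symfun.rep_eq plus_symfun.rep_eq)

text \<open>Nonnegativity excludes cancellation when terms are added, and homogeneity confines the
  support to one degree. The zero function qualifies for every \<open>d\<close>, which covers
  \<open>power_sum 0\<close>.\<close>

definition nonneg_homogeneous :: "nat \<Rightarrow> symfun \<Rightarrow> bool" where
  "nonneg_homogeneous d f \<longleftrightarrow> (\<forall>\<alpha>. 0 \<le> scoeff f \<alpha>) \<and> (\<forall>\<alpha>. scoeff f \<alpha> \<noteq> 0 \<longrightarrow> tdeg \<alpha> = d)"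

lemma nonneg_homogeneous_one: "nonneg_homogeneous 0 1"
  by (auto simp: nonneg_homogeneous_def one_symfun.rep_eq tdeg_def)

lemma nonneg_homogeneous_power_sum: "nonneg_homogeneous k (power_sum k)"
  by (auto simp: nonneg_homogeneous_def power_sum.rep_eq tdeg_def)

lemma nonneg_homogeneous_mult:
  assumes "nonneg_homogeneous d f" "nonneg_homogeneous e g"
  shows "nonneg_homogeneous (d + e) (f * g)"
  unfolding nonneg_homogeneous_def
proof (intro conjI allI impI)
  fix \<gamma>
  show "0 \<le> scoeff (f * g) \<gamma>"
    using assms unfolding times_symfun.rep_eq conv_def nonneg_homogeneous_def
    by (intro sum_nonneg) auto
  assume "scoeff (f * g) \<gamma> \<noteq> 0"
  then obtain p where "p \<in> splits \<gamma>" "(case p of (\<alpha>, \<beta>) \<Rightarrow> scoeff f \<alpha> * scoeff g \<beta>) \<noteq> 0"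
    unfolding times_symfun.rep_eq conv_def by (rule sum.not_neutral_contains_not_neutral)
  thus "tdeg \<gamma> = d + e"
    using assms unfolding nonneg_homogeneous_def splits_def by (auto simp: tdeg_add)
qed

lemma nonneg_homogeneous_power_sum_partition:
  "nonneg_homogeneous (sum_mset ks) (power_sum_partition ks)"
  unfolding power_sum_partition_def
  by (induction ks)
     (simp_all add: nonneg_homogeneous_one nonneg_homogeneous_mult nonneg_homogeneous_power_sum)

text \<open>The coefficient is a multinomial coefficient. For positivity it suffices to strip off
  one variable at a time and keep a single term of the convolution.\<close>

lemma scoeff_power_sum_1_power_pos: "0 < scoeff (power_sum 1 ^ tdeg \<alpha>) \<alpha>"
proof (induction "tdeg \<alpha>" arbitrary: \<alpha>)
  case 0
  hence "\<alpha> = 0"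
    using lookup_le_tdeg[of \<alpha>] by (intro poly_mapping_eqI) simp
  thus ?case
    by (simp add: tdeg_def one_symfun.rep_eq)
next
  case (Suc d)
  then obtain i where "Poly_Mapping.lookup \<alpha> i \<noteq> 0"
    unfolding tdeg_def by (metis nat.distinct(1) sum.neutral)
  \<comment> \<open>The truncated subtraction loses nothing, since the exponent at \<open>i\<close>
    is at least 1.\<close>
  then obtain \<beta> where \<alpha>: "\<alpha> = Poly_Mapping.single i 1 + \<beta>"
    by (intro that[of "\<alpha> - Poly_Mapping.single i 1"] poly_mapping_eqI)
       (auto simp: lookup_add lookup_minus lookup_single when_def)
  hence d: "tdeg \<beta> = d"
    using Suc.hyps(2) tdeg_add[of "Poly_Mapping.single i 1" \<beta>] by (simp add: tdeg_def)
  have nonneg: "0 \<le> scoeff (power_sum 1) \<gamma>" "0 \<le> scoeff (power_sum 1 ^ d) \<gamma>" for \<gamma>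
    using nonneg_homogeneous_power_sum[of 1]
      nonneg_homogeneous_power_sum_partition[of "replicate_mset d 1"]
    by (simp_all add: nonneg_homogeneous_def power_sum_partition_def)
  have "0 < scoeff (power_sum 1) (Poly_Mapping.single i 1) * scoeff (power_sum 1 ^ d) \<beta>"
    using Suc.hyps(1)[of \<beta>] d by (auto simp: power_sum.rep_eq)
  also have "\<dots> \<le> scoeff (power_sum 1 * power_sum 1 ^ d) \<alpha>"
    unfolding times_symfun.rep_eq conv_def
    using member_le_sum[of "(Poly_Mapping.single i 1, \<beta>)" "splits \<alpha>"
        "\<lambda>(\<delta>, \<epsilon>). scoeff (power_sum 1) \<delta> * scoeff (power_sum 1 ^ d) \<epsilon>"]
      nonneg finite_splits[of \<alpha>] \<alpha>
    by (auto simp: splits_def)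
  finally show ?case
    by (simp add: Suc.hyps(2)[symmetric])
qed

section \<open>Cycle types\<close>

text \<open>The orbits partition \<open>{0..<n}\<close>: orbits sharing a point \<open>x\<close>
  both equal the orbit of \<open>x\<close>. This makes every term of \<open>F_mat M\<close>
  homogeneous of degree \<open>n\<close>.\<close>

lemma sum_mset_cycle_type:
  assumes w: "w permutes {0..<n}"
  shows "sum_mset (cycle_type n w) = n"
proof -
  have perm: "permutation w"
    using w by (auto simp: permutation_permutes)
  have sub: "orbit w i \<subseteq> {0..<n}" if "i < n" for i
    using permutes_orbit_subset[OF w, of i] that by simp
  have "orbit w i = orbit w j" if "x \<in> orbit w i" "x \<in> orbit w j" for x i j
    using orbit_cyclic_eq3[OF cyclic_on_orbit'[OF perm]] that by metis
  hence "pairwise disjnt (orbit w ` {0..<n})"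
    unfolding pairwise_def disjnt_def by blast
  moreover have "finite A" if "A \<in> orbit w ` {0..<n}" for A
    using that sub finite_subset[of A "{0..<n}"] by auto
  ultimately have "card (\<Union>(orbit w ` {0..<n})) = sum card (orbit w ` {0..<n})"
    by (rule card_Union_disjoint)
  moreover have "\<Union>(orbit w ` {0..<n}) = {0..<n}"
    using sub permutation_self_in_orbit[OF perm] by (auto simp: subset_iff)
  ultimately show ?thesis
    by (simp add: cycle_type_def sum_unfold_sum_mset)
qed

lemma cycle_type_id: "cycle_type n id = replicate_mset n 1"
proof -
  have "orbit id = (\<lambda>i::nat. {i})"
    by (simp add: fun_eq_iff orbit_eq_singleton_iff)
  \<comment> \<open>Distinct points have distinct orbits, so passing to the set of orbits merges no
    fixed points.\<close>
  moreover have "inj (\<lambda>i::nat. {i})"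
    by (simp add: inj_def)
  ultimately have "mset_set (orbit id ` {0..<n}) = image_mset (\<lambda>i. {i}) (mset_set {0..<n})"
    by (metis image_mset_mset_set inj_on_subset subset_UNIV)
  thus ?thesis
    by (simp add: cycle_type_def multiset.map_comp comp_def image_mset_const_eq)
qed

section \<open>The Newton polytope of a homogeneous symmetric function\<close>

lemma lookup_scaleR: "Poly_Mapping.lookup (r *\<^sub>R v) i = r *\<^sub>R Poly_Mapping.lookup v i"
proof -
  have "finite {i. r *\<^sub>R Poly_Mapping.lookup v i \<noteq> 0}"
    by (rule finite_subset[OF _ finite_lookup[of v]]) auto
  thus ?thesis
    by (simp add: scaleR_poly_mapping_def)
qed

lemma lookup_exponent_vector:
  "Poly_Mapping.lookup (exponent_vector \<alpha>) i = real (Poly_Mapping.lookup \<alpha> i)"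
  by (simp add: exponent_vector_def Poly_Mapping.map.rep_eq when_def)

text \<open>The right-hand side is the standard simplex dilated by \<open>d\<close>; it is convex
  and contains all exponent vectors, hence their hull.\<close>

lemma newton_polytope_homogeneous:
  assumes keys: "\<And>\<alpha>. \<alpha> \<in> Poly_Mapping.keys g \<Longrightarrow> Poly_Mapping.keys \<alpha> \<subseteq> {..<m} \<and> tdeg \<alpha> = d"
  shows "newton_polytope g \<subseteq> {v. (\<forall>i. 0 \<le> Poly_Mapping.lookup v i) \<and>
    (\<forall>i\<ge>m. Poly_Mapping.lookup v i = 0) \<and> (\<Sum>i<m. Poly_Mapping.lookup v i) = real d}"
    (is "_ \<subseteq> ?S")
  unfolding newton_polytope_def
proof (rule hull_minimal)
  show "exponent_vector ` Poly_Mapping.keys g \<subseteq> ?S"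
  proof (safe, goal_cases)
    case (2 _ \<alpha> i)
    thus ?case
      using keys[of \<alpha>] by (auto simp: lookup_exponent_vector in_keys_iff subset_iff not_less)
  next
    case (3 _ \<alpha>)
    thus ?case
      using keys[of \<alpha>] tdeg_superset[of "{..<m}" \<alpha>]
      by (simp add: lookup_exponent_vector flip: of_nat_sum)
  qed (simp add: lookup_exponent_vector)
  show "convex ?S"
    by (rule convexI)
       (simp add: lookup_add lookup_scaleR sum.distrib flip: sum_distrib_left distrib_right)
qed

lemma SNP_zero: "SNP 0"
proof -
  have "restrict_vars m 0 = 0" for m
    by (rule poly_mapping_eqI) (simp add: restrict_vars.rep_eq zero_symfun.rep_eq)
  thus ?thesis
    by (simp add: SNP_def SNP_poly_def newton_polytope_def)
qed

text \<open>A lattice point of the dilated simplex is itself the exponent vector of a monomial of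
  degree \<open>d\<close> in the first \<open>m\<close> variables, and all of these occur.\<close>

lemma SNP_full_support:
  assumes supp: "\<And>\<alpha>. scoeff f \<alpha> \<noteq> 0 \<longleftrightarrow> tdeg \<alpha> = d"
  shows "SNP f"
  unfolding SNP_def SNP_poly_def
proof (intro allI impI ballI)
  fix m v
  let ?g = "restrict_vars m f"
  assume v: "v \<in> newton_polytope ?g" and int: "\<forall>i. Poly_Mapping.lookup v i \<in> \<int>"
  have keys: "\<alpha> \<in> Poly_Mapping.keys ?g \<longleftrightarrow> Poly_Mapping.keys \<alpha> \<subseteq> {..<m} \<and> tdeg \<alpha> = d" for \<alpha>
    by (simp add: in_keys_iff restrict_vars.rep_eq supp)
  have nonneg: "0 \<le> Poly_Mapping.lookup v i"
    and zero: "m \<le> i \<Longrightarrow> Poly_Mapping.lookup v i = 0"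
    and sum: "(\<Sum>i<m. Poly_Mapping.lookup v i) = real d" for i
    using newton_polytope_homogeneous[of ?g m d] v keys by auto
  \<comment> \<open>Rounding down changes no coordinate, as all are nonnegative integers; it only
    converts them to naturals.\<close>
  define \<alpha> where "\<alpha> = Poly_Mapping.map (\<lambda>x. nat \<lfloor>x\<rfloor>) v"
  have \<alpha>: "real (Poly_Mapping.lookup \<alpha> i) = Poly_Mapping.lookup v i" for i
    using nonneg[of i] int by (auto simp: \<alpha>_def Poly_Mapping.map.rep_eq when_def elim!: Ints_cases)
  have "Poly_Mapping.keys \<alpha> \<subseteq> {..<m}"
    using \<alpha> zero by (metis in_keys_iff lessThan_iff not_le_imp_less of_nat_eq_0_iff subsetI)
  moreover have "real (tdeg \<alpha>) = real d"
    using tdeg_superset[of "{..<m}" \<alpha>] calculation sum by (simp add: \<alpha>)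
  ultimately have "\<alpha> \<in> Poly_Mapping.keys ?g"
    by (simp add: keys)
  moreover have "v = exponent_vector \<alpha>"
    by (rule poly_mapping_eqI) (simp add: lookup_exponent_vector \<alpha>)
  ultimately show "v \<in> exponent_vector ` Poly_Mapping.keys ?g"
    by blast
qed

section \<open>The support of \<open>F_mat M\<close>: empty, or all monomials of degree
  \<open>n\<close>\<close>

theorem theorem2p28:
  fixes n :: nat and M :: "real mat"
  assumes "M \<in> carrier_mat n n"
    and "totally_nonneg M"
  shows "SNP (F_mat M)"
proof -
  let ?P = "{w. w permutes {0..<n}}"
  let ?c = "\<lambda>w. \<Prod>i = 0..<n. M $$ (i, w i)"
  let ?p = "\<lambda>w. power_sum_partition (cycle_type n w)"
  have F: "F_mat M = (\<Sum>w\<in>?P. ?c w *\<^sub>R ?p w)"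
    using assms(1) by (simp add: F_mat_def)
  have entry: "0 \<le> M $$ (i, w i)" if "w \<in> ?P" "i < n" for w i
    using totally_nonneg_entry[OF assms(2), of i "w i"] assms(1) that permutes_in_image[of w _ i]
    by simp
  have c: "0 \<le> ?c w" if "w \<in> ?P" for w
    using entry[OF that] by (intro prod_nonneg) simp
  show ?thesis
  proof (cases "\<exists>w\<in>?P. ?c w \<noteq> 0")
    case False
    hence "F_mat M = 0"
      unfolding F by (intro sum.neutral) (metis scaleR_zero_left)
    thus ?thesis
      by (simp add: SNP_zero)
  next
    case True
    then obtain w where w: "w permutes {0..<n}" "?c w \<noteq> 0"
      by blast
    \<comment> \<open>A nonzero product of nonnegative factors has only positive factors.\<close>
    have "0 < M $$ (i, w i)" if "i < n" for i
      using w entry[of w i] that by (auto simp: less_le)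
    hence diag: "0 < ?c id"
      using totally_nonneg_diagonal_pos[OF assms w(1)] by (intro prod_pos) simp
    have coeff: "scoeff (F_mat M) \<alpha> = (\<Sum>w\<in>?P. ?c w * scoeff (?p w) \<alpha>)" for \<alpha>
      by (simp add: F scoeff_sum scaleR_symfun.rep_eq)
    have p: "nonneg_homogeneous n (?p w)" if "w \<in> ?P" for w
      using nonneg_homogeneous_power_sum_partition[of "cycle_type n w"] that
      by (simp add: sum_mset_cycle_type)
    have "scoeff (F_mat M) \<alpha> \<noteq> 0 \<longleftrightarrow> tdeg \<alpha> = n" for \<alpha>
    proof
      assume "scoeff (F_mat M) \<alpha> \<noteq> 0"
      then obtain w where "w \<in> ?P" "?c w * scoeff (?p w) \<alpha> \<noteq> 0"
        unfolding coeff by (rule sum.not_neutral_contains_not_neutral)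
      thus "tdeg \<alpha> = n"
        using p[of w] by (auto simp: nonneg_homogeneous_def)
    next
      assume "tdeg \<alpha> = n"
      hence "0 < ?c id * scoeff (?p id) \<alpha>"
        using scoeff_power_sum_1_power_pos[of \<alpha>] diag
        by (simp add: cycle_type_id power_sum_partition_def)
      \<comment> \<open>All other permutations contribute nonnegative terms, so the identity term is
        a lower bound.\<close>
      also have "\<dots> \<le> scoeff (F_mat M) \<alpha>"
        unfolding coeff using c p
        by (intro member_le_sum)
           (auto simp: permutes_id[unfolded id_def] finite_permutations nonneg_homogeneous_def)
      finally show "scoeff (F_mat M) \<alpha> \<noteq> 0"
        by simp
    qed
    thus ?thesis
      by (rule SNP_full_support)
  qed
qed

end
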